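(* Let $f_1,\dots,f_n:\mathbb{R}^d\to\mathbb{R}$ each be $L$-smooth and $\mu$-strongly convex (with $\mu>0$), and let $x_\star$ be the minimizer of $\frac1n\sum_{i=1}^nf_i$. Let $\mathbf{W}=(W_{ij})_{i,j=1}^n$ be a symmetric, doubly stochastic, positive semi-definite matrix with entries in $[0,1]$, and define its spectral gap as $\delta:=1-\lambda_2(\mathbf{W})\in(0,1)$, where $\lambda_2(\mathbf{W})$ is the second largest eigenvalue of $\mathbf{W}$. Let $p\in(0,1]$, $0<\gamma\le\frac1L$ and $0<\tau\le\frac p\gamma$. Let $(x_{i,t})$ be the iterates of the Decentralized Scaffnew algorithm and $\overline x_T:=\frac1n\sum_{i=1}^nx_{i,T}$. Then for all $T\ge1$, $$\mathbb{E}\left[\|\overline x_T-x_\star\|^2\right]\le\left(1-\min(\gamma\mu,\,p\gamma\tau\delta)\right)^T\Phi_0,$$ for a quantity $\Phi_0$ not depending on $T$ and satisfying $$\Phi_0\le\|x_0-x_\star\|^2+\frac{\gamma}{p\tau\delta n}\sum_{i=1}^n\|\nabla f_i(x_\star)\|^2 .$$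
   Context: $\|\cdot\|$ is the Euclidean norm; a function is $L$-smooth if it is differentiable with $L$-Lipschitz gradient. Decentralized Scaffnew algorithm (stepsizes $\gamma,\tau>0$, probability $p\in(0,1]$, mixing matrix $\mathbf{W}$). Initialize $x_{1,0}=\dots=x_{n,0}=x_0\in\mathbb{R}^d$ and $h_{1,0}=\dots=h_{n,0}=0\in\mathbb{R}^d$. Let $\theta_0,\theta_1,\dots$ be independent $\{0,1\}$-valued random variables with $\mathrm{Prob}(\theta_t=1)=p$. For $t=0,1,2,\dots$ and for every $i=1,\dots,n$: - $\hat x_{i,t+1}=x_{i,t}-\gamma(\nabla f_i(x_{i,t})-h_{i,t})$; - if $\theta_t=1$: $x_{i,t+1}=\left(1-\frac{\gamma\tau}{p}\right)\hat x_{i,t+1}+\frac{\gamma\tau}{p}\sum_{j=1}^nW_{ij}\hat x_{j,t+1}$ and $h_{i,t+1}=h_{i,t}+\frac p\gamma(x_{i,t+1}-\hat x_{i,t+1})$; - if $\theta_t=0$: $x_{i,t+1}=\hat x_{i,t+1}$ and $h_{i,t+1}=h_{i,t}$. *)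

theory Defs
  imports "HOL-Probability.Probability" "HOL-Computational_Algebra.Polynomial"
begin

definition gradient :: "('a::real_inner \<Rightarrow> real) \<Rightarrow> 'a \<Rightarrow> 'a" where
  "gradient f x = (THE g. GDERIV f x :> g)"

definition smooth_fun :: "real \<Rightarrow> ('a::euclidean_space \<Rightarrow> real) \<Rightarrow> bool" where
  "smooth_fun L f \<longleftrightarrow> (\<forall>x. f differentiable (at x)) \<and> L-lipschitz_on UNIV (gradient f)"

definition strongly_convex :: "real \<Rightarrow> ('a::euclidean_space \<Rightarrow> real) \<Rightarrow> bool" where
  "strongly_convex \<mu> f \<longleftrightarrow> convex_on UNIV (\<lambda>x. f x - \<mu> / 2 * (norm x)\<^sup>2)"

definition symmetric_matrix :: "real^'n^'n \<Rightarrow> bool" where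
  "symmetric_matrix A \<longleftrightarrow> transpose A = A"

definition doubly_stochastic :: "real^'n^'n \<Rightarrow> bool" where
  "doubly_stochastic A \<longleftrightarrow>
     (\<forall>i j. 0 \<le> A $ i $ j) \<and> (\<forall>i. (\<Sum>j\<in>UNIV. A $ i $ j) = 1) \<and> (\<forall>j. (\<Sum>i\<in>UNIV. A $ i $ j) = 1)"

definition positive_semidefinite :: "real^'n^'n \<Rightarrow> bool" where
  "positive_semidefinite A \<longleftrightarrow> (\<forall>v. 0 \<le> v \<bullet> (A *v v))"

definition char_polynomial :: "real^'n^'n \<Rightarrow> real poly" where
  "char_polynomial A = det (mat [:0, 1:] - (\<chi> i j. [:A $ i $ j:]))"

text \<open>The real eigenvalues, repeated according to algebraic multiplicity, in decreasing order.
  For a symmetric matrix this list has length \<open>CARD('n)\<close>.\<close>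

definition eigenvalues_decreasing :: "real^'n^'n \<Rightarrow> real list" where
  "eigenvalues_decreasing A = rev (sorted_list_of_multiset (proots (char_polynomial A)))"

text \<open>List positions start at 0, so position 1 is the second largest eigenvalue counted with
  multiplicity. It is meaningful only if \<open>CARD('n) \<ge> 2\<close>.\<close>

definition second_eigenvalue :: "real^'n^'n \<Rightarrow> real" where
  "second_eigenvalue A = eigenvalues_decreasing A ! 1"

definition spectral_gap :: "real^'n^'n \<Rightarrow> real" where
  "spectral_gap A = 1 - second_eigenvalue A"

text \<open>A state \<open>(x, h)\<close> holds the iterate \<open>x i\<close> and the control variate \<open>h i\<close> of every node \<open>i\<close>.
  The Boolean argument of \<open>scaffnew_step\<close> is the coin: \<open>True\<close> means that the nodes communicate.\<close>

definition scaffnew_step ::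
  "('n::finite \<Rightarrow> 'a::euclidean_space \<Rightarrow> real) \<Rightarrow> real^'n^'n \<Rightarrow> real \<Rightarrow> real \<Rightarrow> real \<Rightarrow> bool
     \<Rightarrow> ('n \<Rightarrow> 'a) \<times> ('n \<Rightarrow> 'a) \<Rightarrow> ('n \<Rightarrow> 'a) \<times> ('n \<Rightarrow> 'a)" where
  "scaffnew_step f W \<gamma> \<tau> p b = (\<lambda>(x, h).
     let xh = (\<lambda>i. x i - \<gamma> *\<^sub>R (gradient (f i) (x i) - h i));
         xn = (\<lambda>i. (1 - \<gamma> * \<tau> / p) *\<^sub>R xh i
                     + (\<gamma> * \<tau> / p) *\<^sub>R (\<Sum>j\<in>UNIV. W $ i $ j *\<^sub>R xh j))
     in if b then (xn, \<lambda>i. h i + (p / \<gamma>) *\<^sub>R (xn i - xh i)) else (xh, h))"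

primrec scaffnew_state ::
  "('n::finite \<Rightarrow> 'a::euclidean_space \<Rightarrow> real) \<Rightarrow> real^'n^'n \<Rightarrow> real \<Rightarrow> real \<Rightarrow> real \<Rightarrow> 'a
     \<Rightarrow> (nat \<Rightarrow> bool) \<Rightarrow> nat \<Rightarrow> ('n \<Rightarrow> 'a) \<times> ('n \<Rightarrow> 'a)" where
  "scaffnew_state f W \<gamma> \<tau> p x0 \<theta> 0 = (\<lambda>i. x0, \<lambda>i. 0)"
| "scaffnew_state f W \<gamma> \<tau> p x0 \<theta> (Suc t) =
     scaffnew_step f W \<gamma> \<tau> p (\<theta> t) (scaffnew_state f W \<gamma> \<tau> p x0 \<theta> t)"

definition scaffnew_mean ::
  "('n::finite \<Rightarrow> 'a::euclidean_space \<Rightarrow> real) \<Rightarrow> real^'n^'n \<Rightarrow> real \<Rightarrow> real \<Rightarrow> real \<Rightarrow> 'a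
     \<Rightarrow> (nat \<Rightarrow> bool) \<Rightarrow> nat \<Rightarrow> 'a" where
  "scaffnew_mean f W \<gamma> \<tau> p x0 \<theta> t =
     (1 / real CARD('n)) *\<^sub>R (\<Sum>i\<in>UNIV. fst (scaffnew_state f W \<gamma> \<tau> p x0 \<theta> t) i)"

end

theory Submission
  imports Defs
begin

text \<open>
  Put \<open>A = I - W\<close>, acting on node-indexed vectors. The control variates minus their limits
  \<open>h\<^sub>\<star> i = \<nabla>f i x\<^sub>\<star>\<close> have zero sum, so they have the form \<open>A z\<close>; tracking \<open>z\<close> instead of
  \<open>h\<close> avoids the pseudo-inverse of \<open>A\<close>, and the Lyapunov function is
  \<open>\<parallel>x - x\<^sub>\<star>\<parallel>\<^sup>2 + \<gamma> / (p \<tau>) \<langle>z, A z\<rangle>\<close>. In conditional expectation the cross terms of the primal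
  and dual parts cancel, \<open>A\<^sup>2 \<le> A\<close> absorbs the mixing error since \<open>\<gamma> \<tau> \<le> p\<close>, and
  \<open>\<delta> A \<le> A\<^sup>2\<close> contracts the dual part. The primal part contracts because the gradients are
  cocoercive and strongly monotone.
\<close>

subsection \<open>Gradients of smooth strongly convex functions\<close>

text \<open>Riesz representation: the derivative is the inner product with
  \<open>adjoint f' 1\<close>, and uniqueness of derivatives makes the definite description in
  \<open>gradient\<close> well defined.\<close>

lemma has_gradient:
  fixes f :: "'a::euclidean_space \<Rightarrow> real"
  assumes "f differentiable (at x)"
  shows "(f has_derivative (\<lambda>h. h \<bullet> gradient f x)) (at x)"
proof -
  obtain f' where f': "(f has_derivative f') (at x)"
    using assms by (auto simp: differentiable_def)
  then have "linear f'"
    by (rule has_derivative_linear)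
  then have "f' = (\<lambda>h. h \<bullet> adjoint f' 1)"
    by (simp add: fun_eq_iff adjoint_works)
  with f' have ex: "GDERIV f x :> adjoint f' 1"
    by (simp add: gderiv_def)
  moreover have "D = adjoint f' 1" if "GDERIV f x :> D" for D
  proof -
    have "(\<lambda>h. h \<bullet> D) = (\<lambda>h. h \<bullet> adjoint f' 1)"
      using that ex has_derivative_unique unfolding gderiv_def by blast
    then show ?thesis
      by (metis vector_eq_ldot)
  qed
  ultimately have "GDERIV f x :> gradient f x"
    unfolding gradient_def by (rule theI)
  then show ?thesis
    by (simp add: gderiv_def)
qed

lemma gradient_has_line_derivative:
  fixes f :: "'a::euclidean_space \<Rightarrow> real"
  assumes "\<And>x. f differentiable (at x)"
  shows "((\<lambda>t. f (x + t *\<^sub>R d)) has_real_derivative (d \<bullet> gradient f (x + t *\<^sub>R d))) (at t)"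
proof -
  have "((\<lambda>t. x + t *\<^sub>R d) has_derivative (\<lambda>s. s *\<^sub>R d)) (at t)"
    by (auto intro!: derivative_eq_intros)
  then have "((\<lambda>t. f (x + t *\<^sub>R d)) has_derivative (\<lambda>s. (s *\<^sub>R d) \<bullet> gradient f (x + t *\<^sub>R d))) (at t)"
    by (rule has_derivative_compose) (rule has_gradient[OF assms])
  then show ?thesis
    by (simp add: has_field_derivative_def mult.commute[of _ "d \<bullet> _"])
qed

text \<open>The descent lemma: on the segment from \<open>x\<close> to \<open>y\<close>, the excess
  \<open>\<psi>\<close> of \<open>f\<close> over the quadratic (up to a constant) has nonpositive
  derivative, by Cauchy-Schwarz and the Lipschitz gradient.\<close>

lemma smooth_quadratic_upper_bound:
  assumes "smooth_fun L f"
  shows "f y \<le> f x + (y - x) \<bullet> gradient f x + L / 2 * (norm (y - x))\<^sup>2"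
proof -
  define d where "d = y - x"
  have diff: "\<And>x. f differentiable (at x)" and lip: "L-lipschitz_on UNIV (gradient f)"
    using assms by (auto simp: smooth_fun_def)
  define \<psi> where "\<psi> = (\<lambda>t. f (x + t *\<^sub>R d) - t * (d \<bullet> gradient f x) - L / 2 * t\<^sup>2 * (norm d)\<^sup>2)"
  have "\<psi> 1 \<le> \<psi> 0"
  proof (rule DERIV_nonpos_imp_nonincreasing[where f = \<psi>])
    fix t :: real
    assume t: "0 \<le> t" "t \<le> 1"
    let ?D = "d \<bullet> gradient f (x + t *\<^sub>R d) - d \<bullet> gradient f x - L * t * (norm d)\<^sup>2"
    have "(\<psi> has_real_derivative ?D) (at t)"
      unfolding \<psi>_def
      by (auto intro!: derivative_eq_intros gradient_has_line_derivative diff)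
    moreover have "?D \<le> 0"
    proof -
      have "d \<bullet> (gradient f (x + t *\<^sub>R d) - gradient f x)
          \<le> norm d * norm (gradient f (x + t *\<^sub>R d) - gradient f x)"
        by (rule norm_cauchy_schwarz)
      also have "\<dots> \<le> norm d * (L * norm (t *\<^sub>R d))"
        using lipschitz_onD[OF lip, of "x + t *\<^sub>R d" x]
        by (intro mult_left_mono) (auto simp: dist_norm)
      finally show ?thesis
        using t by (simp add: inner_diff_right power2_eq_square mult_ac)
    qed
    ultimately show "\<exists>D. (\<psi> has_real_derivative D) (at t) \<and> D \<le> 0"
      by blast
  qed simp
  then show ?thesis
    by (simp add: \<psi>_def d_def)
qed

text \<open>On the line through \<open>x\<close> and \<open>y\<close>, the convex function
  \<open>\<phi>\<close> lies above its tangent at 0; the subtracted squares recombine into the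
  square of \<open>norm (y - x)\<close>.\<close>

lemma strongly_convex_quadratic_lower_bound:
  fixes f :: "'a::euclidean_space \<Rightarrow> real"
  assumes "strongly_convex \<mu> f" and diff: "\<And>x. f differentiable (at x)"
  shows "f x + (y - x) \<bullet> gradient f x + \<mu> / 2 * (norm (y - x))\<^sup>2 \<le> f y"
proof -
  define d where "d = y - x"
  define \<phi> where "\<phi> = (\<lambda>t. f (x + t *\<^sub>R d) - \<mu> / 2 * (norm (x + t *\<^sub>R d))\<^sup>2)"
  have cvx: "convex_on UNIV (\<lambda>x. f x - \<mu> / 2 * (norm x)\<^sup>2)"
    using assms(1) by (simp add: strongly_convex_def)
  have "convex_on UNIV \<phi>"
  proof (rule convex_onI)
    fix t a b :: real
    assume t: "0 < t" "t < 1"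
    have "x + ((1 - t) *\<^sub>R a + t *\<^sub>R b) *\<^sub>R d
        = (1 - t) *\<^sub>R (x + a *\<^sub>R d) + t *\<^sub>R (x + b *\<^sub>R d)"
      by (simp add: algebra_simps)
    then show "\<phi> ((1 - t) *\<^sub>R a + t *\<^sub>R b) \<le> (1 - t) * \<phi> a + t * \<phi> b"
      using convex_onD[OF cvx, of t "x + a *\<^sub>R d" "x + b *\<^sub>R d"] t unfolding \<phi>_def by simp
  qed simp
  moreover have "(\<phi> has_real_derivative (d \<bullet> gradient f x - \<mu> * (x \<bullet> d))) (at 0)"
    unfolding \<phi>_def power2_norm_eq_inner inner_add_left inner_add_right
    using gradient_has_line_derivative[OF diff, of x d 0]
    by (auto intro!: derivative_eq_intros simp: inner_commute)
  ultimately have "\<phi> 1 - \<phi> 0 \<ge> (d \<bullet> gradient f x - \<mu> * (x \<bullet> d)) * (1 - 0)"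
    by (intro convex_on_imp_above_tangent[where A = UNIV]) auto
  then show ?thesis
    by (simp add: \<phi>_def d_def power2_norm_eq_inner algebra_simps inner_commute)
qed

text \<open>Adding the quadratic lower bounds based at \<open>x\<close> and at \<open>y\<close>
  eliminates the function values.\<close>

lemma strongly_convex_gradient_monotone:
  fixes f :: "'a::euclidean_space \<Rightarrow> real"
  assumes "strongly_convex \<mu> f" and diff: "\<And>x. f differentiable (at x)"
  shows "\<mu> * (norm (x - y))\<^sup>2 \<le> (x - y) \<bullet> (gradient f x - gradient f y)"
  using strongly_convex_quadratic_lower_bound[OF assms, of x y]
    strongly_convex_quadratic_lower_bound[OF assms, of y x]
  by (simp add: norm_minus_commute algebra_simps)

text \<open>In \<open>half\<close>, the tangent at \<open>a\<close> bounds \<open>f w\<close> from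
  below and the descent lemma at \<open>b\<close> bounds it from above. Adding the two instances
  with swapped roles cancels the function values.\<close>

lemma gradient_cocoercive:
  fixes f :: "'a::euclidean_space \<Rightarrow> real"
  assumes smooth: "smooth_fun L f" and sc: "strongly_convex \<mu> f" and "\<mu> \<ge> 0" "L > 0"
  shows "(norm (gradient f x - gradient f y))\<^sup>2 \<le> L * ((x - y) \<bullet> (gradient f x - gradient f y))"
proof -
  have diff: "\<And>x. f differentiable (at x)"
    using smooth by (auto simp: smooth_fun_def)
  have half: "f a + (b - a) \<bullet> gradient f a + (norm (gradient f b - gradient f a))\<^sup>2 / (2 * L) \<le> f b" for a b
  proof -
    define D where "D = gradient f b - gradient f a"
    \<comment> \<open>This point minimizes the gap between the upper and the lower bound: a gradient
      step of length \<open>1 / L\<close> from \<open>b\<close> on \<open>f\<close> minus its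
      tangent at \<open>a\<close>.\<close>
    define w where "w = b - (1 / L) *\<^sub>R D"
    have "f a + (w - a) \<bullet> gradient f a \<le> f w"
      using strongly_convex_quadratic_lower_bound[OF sc diff, of a w] \<open>\<mu> \<ge> 0\<close>
      by (smt (verit) mult_nonneg_nonneg divide_nonneg_nonneg zero_le_power2)
    also have "\<dots> \<le> f b + (w - b) \<bullet> gradient f b + L / 2 * (norm (w - b))\<^sup>2"
      by (rule smooth_quadratic_upper_bound[OF smooth])
    finally have "f a + (b - a) \<bullet> gradient f a + (1 / L) * (D \<bullet> (gradient f b - gradient f a))
        \<le> f b + L / 2 * (norm ((1 / L) *\<^sub>R D))\<^sup>2"
      by (simp add: w_def algebra_simps)
    moreover have "L / 2 * (norm ((1 / L) *\<^sub>R D))\<^sup>2 = (norm D)\<^sup>2 / (2 * L)"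
      using \<open>L > 0\<close> by (simp add: power2_eq_square field_simps)
    ultimately show ?thesis
      unfolding D_def[symmetric] power2_norm_eq_inner by simp
  qed
  have "(norm (gradient f x - gradient f y))\<^sup>2 / L \<le> (x - y) \<bullet> (gradient f x - gradient f y)"
    using half[of x y] half[of y x] \<open>L > 0\<close>
    by (simp add: norm_minus_commute algebra_simps)
  then show ?thesis
    using \<open>L > 0\<close> by (simp add: field_simps)
qed

text \<open>The expanded square contains the inner product with \<open>- 2 * \<gamma>\<close>. One
  half absorbs the squared gradient difference through cocoercivity and
  \<open>\<gamma> \<le> 1 / L\<close>; the other yields the rate through strong
  monotonicity.\<close>

lemma gradient_step_contraction:
  fixes f :: "'a::euclidean_space \<Rightarrow> real"
  assumes smooth: "smooth_fun L f" and sc: "strongly_convex \<mu> f"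
    and "\<mu> \<ge> 0" "0 < \<gamma>" "\<gamma> \<le> 1 / L"
  shows "(norm (x - y - \<gamma> *\<^sub>R (gradient f x - gradient f y)))\<^sup>2 \<le> (1 - \<gamma> * \<mu>) * (norm (x - y))\<^sup>2"
proof -
  \<comment> \<open>Since \<open>1 / 0 = 0\<close>, a positive \<open>\<gamma>\<close> below
    \<open>1 / L\<close> excludes \<open>L = 0\<close> as well as negative \<open>L\<close>.\<close>
  have "L > 0"
    using \<open>0 < \<gamma>\<close> \<open>\<gamma> \<le> 1 / L\<close> by (metis less_le_trans zero_less_divide_1_iff)
  define D where "D = gradient f x - gradient f y"
  have co: "(norm D)\<^sup>2 \<le> L * ((x - y) \<bullet> D)"
    unfolding D_def using gradient_cocoercive assms(1-3) \<open>L > 0\<close> by blast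
  have mon: "\<mu> * (norm (x - y))\<^sup>2 \<le> (x - y) \<bullet> D"
    unfolding D_def using smooth by (intro strongly_convex_gradient_monotone sc) (auto simp: smooth_fun_def)
  have "\<gamma> * (norm D)\<^sup>2 \<le> 1 / L * (norm D)\<^sup>2"
    using \<open>\<gamma> \<le> 1 / L\<close> by (rule mult_right_mono) simp
  also have "\<dots> \<le> (x - y) \<bullet> D"
    using co \<open>L > 0\<close> by (simp add: field_simps)
  finally have "\<gamma> * (\<gamma> * (norm D)\<^sup>2) \<le> \<gamma> * ((x - y) \<bullet> D)"
    using \<open>0 < \<gamma>\<close> by simp
  moreover have "\<gamma> * (\<mu> * (norm (x - y))\<^sup>2) \<le> \<gamma> * ((x - y) \<bullet> D)"
    using mon \<open>0 < \<gamma>\<close> by simp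
  moreover have "(norm (x - y - \<gamma> *\<^sub>R D))\<^sup>2
      = (norm (x - y))\<^sup>2 - 2 * (\<gamma> * ((x - y) \<bullet> D)) + \<gamma> * (\<gamma> * (norm D)\<^sup>2)"
    by (simp add: power2_norm_eq_inner inner_diff_left inner_diff_right inner_commute algebra_simps)
  ultimately show ?thesis
    unfolding D_def[symmetric] by (simp add: algebra_simps)
qed

text \<open>Fermat's rule. It puts the vector of limiting control variates into the range of
  \<open>I - W\<close>.\<close>

lemma minimizer_sum_gradient:
  fixes f :: "'n::finite \<Rightarrow> 'a::euclidean_space \<Rightarrow> real"
  assumes diff: "\<And>i x. f i differentiable (at x)"
    and "c > 0" and min: "is_arg_min (\<lambda>x. c * (\<Sum>i\<in>UNIV. f i x)) (\<lambda>_. True) xstar"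
  shows "(\<Sum>i\<in>UNIV. gradient (f i) xstar) = 0"
proof -
  have "((\<lambda>x. \<Sum>i\<in>UNIV. f i x) has_derivative (\<lambda>h. \<Sum>i\<in>UNIV. h \<bullet> gradient (f i) xstar)) (at xstar)"
    by (intro has_derivative_sum has_gradient diff)
  moreover have "\<forall>y\<in>UNIV. (\<Sum>i\<in>UNIV. f i xstar) \<le> (\<Sum>i\<in>UNIV. f i y)"
    using min \<open>c > 0\<close> by (auto simp: is_arg_min_linorder)
  ultimately have "(\<lambda>h. \<Sum>i\<in>UNIV. h \<bullet> gradient (f i) xstar) = (\<lambda>_. 0)"
    using differential_zero_maxmin[of xstar UNIV] by blast
  then show ?thesis
    by (metis inner_sum_right inner_eq_zero_iff)
qed

subsection \<open>Algebraic multiplicity and the spectral gap\<close>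

text \<open>Evaluation is a ring homomorphism, so it commutes with the Leibniz expansion.\<close>

lemma poly_det: "poly (det A) x = det (\<chi> i j. poly (A $ i $ j) x)"
  for A :: "('a::comm_ring_1 poly)^'n^'n"
  by (simp add: det_def poly_sum poly_prod)

lemma poly_char_polynomial: "poly (char_polynomial A) x = det (mat x - A)"
  unfolding char_polynomial_def poly_det
  by (intro arg_cong[where f = det]) (simp add: vec_eq_iff mat_def)

lemma scalar_mat_mult_vec: "(mat x :: real^'n^'n) *v v = x *\<^sub>R v"
  by (simp add: vec_eq_iff matrix_vector_mult_def mat_def if_distrib[of "\<lambda>a. a * _"] cong: if_cong)

lemma char_matrix_mult_eigenvector:
  fixes A :: "real^'n^'n"
  assumes "A *v v = a *\<^sub>R v"
  shows "(mat x - A) *v v = (x - a) *\<^sub>R v"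
  using assms by (simp add: matrix_vector_mult_diff_rdistrib scalar_mat_mult_vec scaleR_left_diff_distrib)

lemma eigenvalue_imp_char_polynomial_root:
  fixes A :: "real^'n^'n"
  assumes "A *v v = a *\<^sub>R v" "v \<noteq> 0"
  shows "poly (char_polynomial A) a = 0"
proof -
  have "(mat a - A) *v v = 0"
    using char_matrix_mult_eigenvector[OF assms(1), of a] by simp
  then have "\<not> invertible (mat a - A)"
    using \<open>v \<noteq> 0\<close> matrix_left_invertible_ker[of "mat a - A"] invertible_left_inverse by blast
  then show ?thesis
    by (simp add: poly_char_polynomial invertible_det_nz)
qed

text \<open>Replacing columns \<open>i\<close> and \<open>j\<close> of \<open>x I - A\<close> by \<open>u\<close> and \<open>v\<close> divides its determinant
  by \<open>(x - a)\<^sup>2\<close>, up to a nonzero constant.\<close>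

lemma double_eigenvalue_dvd_char_polynomial:
  fixes A :: "real^'n^'n"
  assumes u: "A *v u = a *\<^sub>R u" and v: "A *v v = a *\<^sub>R v"
    and nz: "u $ i \<noteq> 0" "v $ i = 0" "v $ j \<noteq> 0"
  shows "[:-a, 1:]\<^sup>2 dvd char_polynomial A"
proof -
  define N where "N = (\<chi> r c. if c = j then [:v $ r:] else if c = i then [:u $ r:]
    else (mat [:0, 1:] - (\<chi> i j. [:A $ i $ j:])) $ r $ c)"
  \<comment> \<open>The extra factor makes both sides vanish at \<open>a\<close>, the one point
    where dividing by \<open>x - a\<close> fails; it is cancelled once the polynomials are known to
    agree everywhere.\<close>
  have "[:-a, 1:] * smult (u $ i * v $ j) (char_polynomial A) = [:-a, 1:] * ([:-a, 1:]\<^sup>2 * det N)"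
  proof -
    have "poly ([:-a, 1:] * smult (u $ i * v $ j) (char_polynomial A)) x
      = poly ([:-a, 1:] * ([:-a, 1:]\<^sup>2 * det N)) x" for x
    proof (cases "x = a")
      case False
      define M where "M = mat x - A"
      define M1 where "M1 = (\<chi> r c. if c = i then u $ r else M $ r $ c)"
      define M2 where "M2 = (\<chi> r c. if c = j then v $ r else M1 $ r $ c)"
      have Mu: "M *v ((1 / (x - a)) *\<^sub>R u) = u" and Mv: "M *v ((1 / (x - a)) *\<^sub>R v) = v"
        using char_matrix_mult_eigenvector[OF u, of x] char_matrix_mult_eigenvector[OF v, of x] False
        by (simp_all add: M_def matrix_vector_mult_scaleR)
      \<comment> \<open>Only column \<open>i\<close> differs between \<open>M\<close> and
        \<open>M1\<close>, and it is multiplied by \<open>v $ i = 0\<close>.\<close>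
      have M1v: "M1 *v ((1 / (x - a)) *\<^sub>R v) = v"
      proof -
        have "M1 *v ((1 / (x - a)) *\<^sub>R v) = M *v ((1 / (x - a)) *\<^sub>R v)"
          using nz(2) by (auto simp: vec_eq_iff matrix_vector_mult_def M1_def intro!: sum.cong)
        with Mv show ?thesis by simp
      qed
      have "det M1 = u $ i / (x - a) * det M"
        using cramer_lemma[of i M "(1 / (x - a)) *\<^sub>R u", unfolded Mu] by (simp add: M1_def)
      moreover have "det M2 = v $ j / (x - a) * det M1"
        using cramer_lemma[of j M1 "(1 / (x - a)) *\<^sub>R v", unfolded M1v] by (simp add: M2_def)
      moreover have "poly (det N) x = det M2"
        unfolding poly_det
        by (intro arg_cong[where f = det])
          (simp add: vec_eq_iff N_def M2_def M1_def M_def mat_def)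
      moreover have "poly [:-a, 1:] x = x - a"
        by simp
      moreover have "y * (c * d * D) = y * (y\<^sup>2 * (d / y * (c / y * D)))" if "y \<noteq> 0" for y c d D :: real
        using that by (simp add: power2_eq_square)
      moreover have "x - a \<noteq> 0"
        using False by simp
      ultimately show ?thesis
        by (simp only: poly_mult poly_smult poly_power poly_char_polynomial M_def[symmetric])
    qed simp
    then show ?thesis
      by (simp only: poly_eq_poly_eq_iff[symmetric] fun_eq_iff) blast
  qed
  then have "smult (u $ i * v $ j) (char_polynomial A) = [:-a, 1:]\<^sup>2 * det N"
    by (subst (asm) mult_cancel_left) simp
  then have "[:-a, 1:]\<^sup>2 dvd smult (u $ i * v $ j) (char_polynomial A)"
    by simp
  then show ?thesis
    using nz by (simp add: dvd_smult_iff)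
qed

text \<open>If the second entry of a decreasing list is below \<open>c\<close>, at most the head
  reaches \<open>c\<close>, while the submultiset supplies two such entries. Multiset inclusion also
  covers \<open>a = b\<close> as a value of multiplicity two.\<close>

lemma nth_1_rev_sorted_list_of_multiset_ge:
  fixes M :: "real multiset"
  assumes "{#a, b#} \<subseteq># M" "c \<le> a" "c \<le> b"
  shows "c \<le> rev (sorted_list_of_multiset M) ! 1"
proof (rule ccontr)
  define l where "l = rev (sorted_list_of_multiset M)"
  assume "\<not> ?thesis"
  then have lt: "l ! 1 < c"
    by (simp add: l_def)
  have mset: "mset l = M"
    by (simp add: l_def)
  have sorted: "sorted_wrt (\<ge>) l"
    by (simp add: l_def sorted_wrt_rev)
  have len: "length l \<ge> 2"
    using size_mset_mono[OF assms(1)] by (simp flip: mset)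
  obtain y l' where "l = y # l'"
    using len by (cases l) auto
  moreover obtain z r where "l' = z # r"
    using len \<open>l = y # l'\<close> by (cases l') auto
  ultimately have l: "l = y # z # r"
    by simp
  have "filter_mset (\<lambda>x. c \<le> x) (mset (z # r)) = {#}"
    using lt sorted unfolding filter_mset_eq_mempty_iff l by fastforce
  then have "filter_mset (\<lambda>x. c \<le> x) M \<subseteq># {#y#}"
    unfolding mset[symmetric] l by simp
  moreover have "{#a, b#} \<subseteq># filter_mset (\<lambda>x. c \<le> x) M"
    using multiset_filter_mono[OF assms(1), of "\<lambda>x. c \<le> x"] assms(2,3) by simp
  ultimately have "{#a, b#} \<subseteq># {#y#}"
    by order
  then show False
    using size_mset_mono by fastforce
qed

text \<open>The maximizer of the quadratic form on the unit sphere of an invariant subspace is an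
  eigenvector, by the first variation.\<close>

lemma selfadjoint_max_eigenvector:
  fixes T :: "'a::euclidean_space \<Rightarrow> 'a"
  assumes T: "linear T" and selfadj: "\<And>x y. T x \<bullet> y = x \<bullet> T y"
    and S: "subspace S" "\<And>x. x \<in> S \<Longrightarrow> T x \<in> S" and nontriv: "\<exists>x\<in>S. x \<noteq> 0"
  obtains v a where "v \<in> S" "norm v = 1" "T v = a *\<^sub>R v" "\<And>x. x \<in> S \<Longrightarrow> x \<bullet> T x \<le> a * (norm x)\<^sup>2"
proof -
  interpret T: linear T by (rule T)
  have "compact (sphere 0 1 \<inter> S)"
    using closed_subspace[OF S(1)] by (intro compact_Int_closed) auto
  moreover obtain x0 where "x0 \<in> S" "x0 \<noteq> 0"
    using nontriv by blast
  then have "(1 / norm x0) *\<^sub>R x0 \<in> sphere 0 1 \<inter> S"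
    using S(1) by (auto simp: subspace_scale)
  then have "sphere 0 1 \<inter> S \<noteq> {}"
    by blast
  moreover have "continuous_on (sphere 0 1 \<inter> S) (\<lambda>x. x \<bullet> T x)"
    by (intro continuous_intros linear_continuous_on linear_conv_bounded_linear[THEN iffD1] T)
  ultimately have "\<exists>v\<in>sphere 0 1 \<inter> S. \<forall>x\<in>sphere 0 1 \<inter> S. x \<bullet> T x \<le> v \<bullet> T v"
    by (rule continuous_attains_sup)
  then obtain v where v: "v \<in> S" "norm v = 1"
    and max: "\<And>x. x \<in> S \<Longrightarrow> norm x = 1 \<Longrightarrow> x \<bullet> T x \<le> v \<bullet> T v"
    by (auto simp: dist_norm)
  define a where "a = v \<bullet> T v"
  have le: "x \<bullet> T x \<le> a * (norm x)\<^sup>2" if "x \<in> S" for x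
  proof (cases "x = 0")
    case False
    then have "((1 / norm x) *\<^sub>R x) \<bullet> T ((1 / norm x) *\<^sub>R x) \<le> a"
      unfolding a_def using that S(1) by (intro max) (auto simp: subspace_scale)
    then show ?thesis
      using False by (simp add: T.scaleR power2_eq_square field_simps)
  qed (simp add: T.zero)
  \<comment> \<open>The residual of the eigenvector equation; varying \<open>v\<close> in this
    direction forces it to vanish.\<close>
  define w where "w = a *\<^sub>R v - T v"
  have "w \<in> S"
    unfolding w_def using S v by (simp add: subspace_diff subspace_scale)
  have "w \<bullet> w = 0"
  proof (rule ccontr)
    assume "w \<bullet> w \<noteq> 0"
    then have pos: "w \<bullet> w > 0" by simp
    define b where "b = a * (w \<bullet> w) - w \<bullet> T w"
    \<comment> \<open>The Rayleigh bound at \<open>v - t *\<^sub>R w\<close>: zeroth-order terms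
      cancel and the first-order coefficient is \<open>- 2 * (w \<bullet> w)\<close>.\<close>
    have ineq: "0 \<le> - 2 * t * (w \<bullet> w) + t\<^sup>2 * b" for t
    proof -
      have "(v - t *\<^sub>R w) \<bullet> T (v - t *\<^sub>R w) \<le> a * ((v - t *\<^sub>R w) \<bullet> (v - t *\<^sub>R w))"
        using le[of "v - t *\<^sub>R w"] S(1) v \<open>w \<in> S\<close>
        by (simp add: subspace_diff subspace_scale power2_norm_eq_inner)
      moreover have "v \<bullet> v = 1"
        using v by (simp add: norm_eq_1)
      moreover have "v \<bullet> T w = w \<bullet> T v"
        by (metis selfadj inner_commute)
      moreover have "w \<bullet> T v = a * (w \<bullet> v) - w \<bullet> w"
        by (subst (4) w_def) (simp add: inner_diff_right)
      ultimately show ?thesis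
        unfolding b_def
        by (simp add: T.diff T.scaleR a_def[symmetric] inner_diff_left inner_diff_right
            inner_commute[of v w] power2_eq_square algebra_simps)
    qed
    \<comment> \<open>Small enough that \<open>t * b \<le> w \<bullet> w\<close>, so the linear term
      wins; the summand 1 keeps the denominator positive.\<close>
    define t where "t = (w \<bullet> w) / (1 + \<bar>b\<bar>)"
    have "t > 0"
      unfolding t_def using pos by (simp add: field_simps)
    have "t * b \<le> t * (1 + \<bar>b\<bar>)"
      using \<open>t > 0\<close> by (intro mult_left_mono) auto
    also have "\<dots> = w \<bullet> w"
      unfolding t_def by simp
    finally have "t * (t * b) \<le> t * (w \<bullet> w)"
      using \<open>t > 0\<close> by simp
    moreover have "t * (w \<bullet> w) > 0"
      using \<open>t > 0\<close> pos by simp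
    ultimately show False
      using ineq[of t] by (simp add: power2_eq_square algebra_simps)
  qed
  then have "T v = a *\<^sub>R v"
    by (simp add: w_def)
  with v le show ?thesis
    using that by blast
qed

text \<open>The maximum \<open>a\<close> of the Rayleigh quotient on the mean-zero subspace is an
  eigenvalue, and the constant vector has eigenvalue 1. With \<open>a \<le> 1\<close>, these are two
  entries of the spectrum, counted with multiplicity, that are at least \<open>a\<close>.\<close>

lemma rayleigh_le_second_eigenvalue:
  fixes W :: "real^'n^'n"
  assumes card: "CARD('n) \<ge> 2" and sym: "symmetric_matrix W"
    and ds: "doubly_stochastic W" and psd: "positive_semidefinite W"
    and v: "(\<Sum>i\<in>UNIV. v $ i) = 0"
  shows "v \<bullet> (W *v v) \<le> second_eigenvalue W * (norm v)\<^sup>2"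
proof -
  define S where "S = {x :: real^'n. (\<Sum>i\<in>UNIV. x $ i) = 0}"
  have one: "W *v 1 = 1 *\<^sub>R 1"
    using ds by (simp add: doubly_stochastic_def vec_eq_iff matrix_vector_mult_def)
  have selfadj: "(W *v x) \<bullet> y = x \<bullet> (W *v y)" for x y
    using sym by (metis symmetric_matrix_def dot_lmul_matrix vector_transpose_matrix)
  have S: "subspace S" "\<And>x. x \<in> S \<Longrightarrow> W *v x \<in> S"
  proof -
    show "subspace S"
      by (auto simp: subspace_def S_def sum.distrib simp flip: sum_distrib_left)
    fix x assume "x \<in> S"
    have "1 \<bullet> (W *v x) = 1 \<bullet> x"
      using selfadj[of 1 x] one by simp
    with \<open>x \<in> S\<close> show "W *v x \<in> S"
      by (simp add: S_def inner_vec_def)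
  qed
  obtain i j :: 'n where "i \<noteq> j"
    using card by (metis card_2_iff' ex_card numeral_2_eq_2)
  then have "axis i 1 - axis j 1 \<in> S" "axis i 1 - axis j (1::real) \<noteq> 0"
    by (auto simp: S_def sum_subtractf axis_def vec_eq_iff)
  then have "\<exists>x\<in>S. x \<noteq> 0" by blast
  with S selfadj obtain u a where u: "u \<in> S" "norm u = 1" "W *v u = a *\<^sub>R u"
    and max: "\<And>x. x \<in> S \<Longrightarrow> x \<bullet> (W *v x) \<le> a * (norm x)\<^sup>2"
    using selfadjoint_max_eigenvector[of "(*v) W" S] by (metis matrix_vector_mul_linear)
  \<comment> \<open>Positive semi-definiteness rules out the eigenvalue -1, so the polynomial is
    nonzero there; only then do \<open>proots\<close> and \<open>order\<close> count roots.\<close>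
  have nz: "char_polynomial W \<noteq> 0"
  proof
    assume "char_polynomial W = 0"
    then have "\<not> invertible (mat (-1) - W)"
      by (metis poly_char_polynomial poly_0 invertible_det_nz)
    then obtain x where x: "(mat (-1) - W) *v x = 0" "x \<noteq> 0"
      using matrix_left_invertible_ker invertible_left_inverse by blast
    then have "W *v x = - x"
      by (simp add: matrix_vector_mult_diff_rdistrib scalar_mat_mult_vec algebra_simps)
    then have "x \<bullet> (W *v x) < 0"
      using x by simp
    then show False
      using psd by (metis positive_semidefinite_def not_le)
  qed
  have "{#1, a#} \<subseteq># proots (char_polynomial W)" if "a \<noteq> 1"
  proof -
    have "poly (char_polynomial W) 1 = 0" "poly (char_polynomial W) a = 0"
      using one u by (auto intro: eigenvalue_imp_char_polynomial_root)
    then show ?thesis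
      using nz that by (auto simp: subseteq_mset_def Suc_le_eq order_gt_0_iff)
  qed
  \<comment> \<open>Here the eigenvalue 1 must be shown to be a double root. Subtracting a multiple
    of the constant vector from \<open>u\<close> gives an eigenvector vanishing at \<open>i\<close>,
    nonzero because the mean-zero \<open>u\<close> is not constant.\<close>
  moreover have "{#1, 1#} \<subseteq># proots (char_polynomial W)" if "a = 1"
  proof -
    obtain i where "u $ i \<noteq> 0"
      using u(2) by (metis norm_zero zero_neq_one vec_eq_iff zero_index)
    define z where "z = u - u $ i *\<^sub>R 1"
    have "z \<noteq> 0"
    proof
      assume "z = 0"
      then have "u $ k = u $ i" for k
        by (simp add: z_def vec_eq_iff)
      then have "(\<Sum>k\<in>UNIV. u $ k) = (\<Sum>k\<in>(UNIV::'n set). u $ i)"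
        by (rule sum.cong[OF refl])
      with u(1) \<open>u $ i \<noteq> 0\<close> show False
        by (simp add: S_def)
    qed
    then obtain j where "z $ j \<noteq> 0"
      by (metis vec_eq_iff zero_index)
    moreover have "z $ i = 0"
      by (simp add: z_def)
    moreover have "W *v z = 1 *\<^sub>R z"
      using u(3) one that by (simp add: z_def matrix_vector_mult_diff_distrib matrix_vector_mult_scaleR)
    ultimately have "[:-1, 1:]\<^sup>2 dvd char_polynomial W"
      using double_eigenvalue_dvd_char_polynomial[OF one] by simp
    then have "order 1 (char_polynomial W) \<ge> 2"
      using nz by (simp add: order_divides)
    then show ?thesis
      using nz by (auto simp: subseteq_mset_def)
  qed
  \<comment> \<open>Maximum principle: at a coordinate of largest modulus, \<open>W *v u\<close> is
    an average of entries no larger in modulus.\<close>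
  moreover have "a \<le> 1"
  proof -
    obtain i where i: "\<And>j. \<bar>u $ j\<bar> \<le> \<bar>u $ i\<bar>"
      using finite_has_maximal[of "range (\<lambda>j. \<bar>u $ j\<bar>)"]
      by (smt (verit) UNIV_not_empty empty_is_image finite finite_imageI imageE rangeI)
    have W: "\<And>j. 0 \<le> W $ i $ j" "(\<Sum>j\<in>UNIV. W $ i $ j) = 1"
      using ds by (auto simp: doubly_stochastic_def)
    have "a * \<bar>u $ i\<bar> \<le> \<bar>(a *\<^sub>R u) $ i\<bar>"
      by (simp add: abs_mult mult_right_mono)
    also have "\<dots> = \<bar>\<Sum>j\<in>UNIV. W $ i $ j * u $ j\<bar>"
      unfolding u(3)[symmetric] by (simp add: matrix_vector_mult_def)
    also have "\<dots> \<le> (\<Sum>j\<in>UNIV. W $ i $ j * \<bar>u $ j\<bar>)"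
      using sum_abs[of "\<lambda>j. W $ i $ j * u $ j" UNIV] W by (simp add: abs_mult)
    also have "\<dots> \<le> (\<Sum>j\<in>UNIV. W $ i $ j * \<bar>u $ i\<bar>)"
      using i W by (intro sum_mono mult_left_mono) auto
    also have "\<dots> = \<bar>u $ i\<bar>"
      using W by (simp flip: sum_distrib_right)
    finally have "a * \<bar>u $ i\<bar> \<le> 1 * \<bar>u $ i\<bar>"
      by simp
    moreover have "\<bar>u $ i\<bar> > 0"
    proof (rule ccontr)
      assume "\<not> \<bar>u $ i\<bar> > 0"
      then have "u = 0"
        using i by (simp add: vec_eq_iff)
      with u(2) show False by simp
    qed
    ultimately show ?thesis
      by (simp only: mult_le_cancel_right_pos)
  qed
  ultimately have "a \<le> second_eigenvalue W"
    unfolding second_eigenvalue_def eigenvalues_decreasing_def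
    by (cases "a = 1") (blast intro: nth_1_rev_sorted_list_of_multiset_ge order_refl)+
  then have "a * (norm v)\<^sup>2 \<le> second_eigenvalue W * (norm v)\<^sup>2"
    by (rule mult_right_mono) simp
  with max[of v] v show ?thesis
    by (simp add: S_def)
qed

subsection \<open>Recursions driven by independent coins\<close>

context prob_space
begin

text \<open>A function of the first \<open>t\<close> coins factors through the finite set of
  histories, hence is measurable and bounded by the sum of its absolute values over that
  set.\<close>

lemma integrable_finite_history:
  fixes G :: "(nat \<Rightarrow> bool) \<Rightarrow> real"
  assumes meas: "\<And>i. random_variable (count_space UNIV) (\<theta> i)"
    and G: "\<And>a b. (\<And>i. i < t \<Longrightarrow> a i = b i) \<Longrightarrow> G a = G b"
  shows "integrable M (\<lambda>\<omega>. G (\<lambda>i. \<theta> i \<omega>))"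
proof -
  let ?H = "\<lambda>\<omega>. restrict (\<lambda>i. \<theta> i \<omega>) {..<t}"
  let ?P = "PiE {..<t} (\<lambda>_. UNIV :: bool set)"
  have eq: "G (\<lambda>i. \<theta> i \<omega>) = G (?H \<omega>)" for \<omega>
    by (rule G) simp
  have "?H \<in> M \<rightarrow>\<^sub>M PiM {..<t} (\<lambda>_. count_space UNIV)"
    by (intro measurable_restrict meas)
  then have "?H \<in> M \<rightarrow>\<^sub>M count_space ?P"
    by (simp add: count_space_PiM_finite)
  then have "(\<lambda>\<omega>. G (?H \<omega>)) \<in> borel_measurable M"
    by (rule measurable_compose) simp
  moreover have "\<bar>G (?H \<omega>)\<bar> \<le> (\<Sum>h\<in>?P. \<bar>G h\<bar>)" for \<omega>
    by (rule member_le_sum[of _ ?P "\<lambda>h. \<bar>G h\<bar>"]) (auto intro: finite_PiE)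
  ultimately show ?thesis
    unfolding eq by (intro integrable_const_bound[where B = "\<Sum>h\<in>?P. \<bar>G h\<bar>"]) auto
qed

text \<open>The coins before \<open>t\<close> and the coin at \<open>t\<close> are disjoint blocks
  of an independent family, so functions of them are independent.\<close>

lemma expectation_next_coin_mult:
  fixes G :: "(nat \<Rightarrow> bool) \<Rightarrow> real" and g :: "bool \<Rightarrow> real"
  assumes ind: "indep_vars (\<lambda>_. count_space UNIV) \<theta> UNIV"
    and G: "\<And>a b. (\<And>i. i < t \<Longrightarrow> a i = b i) \<Longrightarrow> G a = G b"
  shows "expectation (\<lambda>\<omega>. G (\<lambda>i. \<theta> i \<omega>) * g (\<theta> t \<omega>))
    = expectation (\<lambda>\<omega>. G (\<lambda>i. \<theta> i \<omega>)) * expectation (\<lambda>\<omega>. g (\<theta> t \<omega>))"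
proof -
  have meas: "\<And>i. random_variable (count_space UNIV) (\<theta> i)"
    using ind by (simp add: indep_vars_def)
  let ?H = "\<lambda>\<omega>. restrict (\<lambda>i. \<theta> i \<omega>) {..<t}"
  let ?K = "\<lambda>\<omega>. restrict (\<lambda>i. \<theta> i \<omega>) {t}"
  have eq: "G (\<lambda>i. \<theta> i \<omega>) = G (?H \<omega>)" for \<omega>
    by (rule G) simp
  have "indep_var (PiM {..<t} (\<lambda>_. count_space UNIV)) ?H (PiM {t} (\<lambda>_. count_space UNIV)) ?K"
    by (rule indep_var_restrict[OF ind]) auto
  moreover have "G \<in> PiM {..<t} (\<lambda>_. count_space (UNIV :: bool set)) \<rightarrow>\<^sub>M borel"
    by (simp add: count_space_PiM_finite)
  moreover have "(\<lambda>k. g (k t)) \<in> PiM {t} (\<lambda>_. count_space (UNIV :: bool set)) \<rightarrow>\<^sub>M borel"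
    by (simp add: count_space_PiM_finite)
  ultimately have "indep_var borel (G \<circ> ?H) borel ((\<lambda>k. g (k t)) \<circ> ?K)"
    by (rule indep_var_compose)
  then have "indep_var borel (\<lambda>\<omega>. G (\<lambda>i. \<theta> i \<omega>)) borel (\<lambda>\<omega>. g (\<theta> t \<omega>))"
    by (simp add: o_def eq)
  moreover have "integrable M (\<lambda>\<omega>. G (\<lambda>i. \<theta> i \<omega>))"
    by (rule integrable_finite_history[OF meas G])
  moreover have "integrable M (\<lambda>\<omega>. g (\<theta> t \<omega>))"
    by (rule integrable_finite_history[OF meas, of "Suc t" "\<lambda>a. g (a t)"]) simp
  ultimately show ?thesis
    by (simp add: indep_var_lebesgue_integral)
qed

text \<open>This replaces conditioning on the past: splitting by the indicators of the two coin
  values freezes the first argument of \<open>G\<close>, and each indicator then factors out of the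
  expectation.\<close>

lemma expectation_next_coin:
  fixes G :: "bool \<Rightarrow> (nat \<Rightarrow> bool) \<Rightarrow> real"
  assumes ind: "indep_vars (\<lambda>_. count_space UNIV) \<theta> UNIV"
    and p: "prob {\<omega> \<in> space M. \<theta> t \<omega>} = p"
    and G: "\<And>c a b. (\<And>i. i < t \<Longrightarrow> a i = b i) \<Longrightarrow> G c a = G c b"
  shows "expectation (\<lambda>\<omega>. G (\<theta> t \<omega>) (\<lambda>i. \<theta> i \<omega>))
    = expectation (\<lambda>\<omega>. p * G True (\<lambda>i. \<theta> i \<omega>) + (1 - p) * G False (\<lambda>i. \<theta> i \<omega>))"
proof -
  have meas: "\<And>i. random_variable (count_space UNIV) (\<theta> i)"
    using ind by (simp add: indep_vars_def)
  have int: "integrable M (\<lambda>\<omega>. F (\<lambda>i. \<theta> i \<omega>))"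
    if "\<And>a b. (\<And>i. i < Suc t \<Longrightarrow> a i = b i) \<Longrightarrow> F a = F b" for F :: "(nat \<Rightarrow> bool) \<Rightarrow> real"
    using that by (rule integrable_finite_history[OF meas])
  have intG: "integrable M (\<lambda>\<omega>. G c (\<lambda>i. \<theta> i \<omega>))" for c
    by (intro int G) auto
  have [simp]: "expectation (\<lambda>\<omega>. of_bool (\<theta> t \<omega>)) = p"
  proof -
    have "expectation (\<lambda>\<omega>. of_bool (\<theta> t \<omega>)) = expectation (indicator {\<omega> \<in> space M. \<theta> t \<omega>})"
      by (rule Bochner_Integration.integral_cong) (auto simp: indicator_def)
    also have "{\<omega> \<in> space M. \<theta> t \<omega>} \<inter> space M = {\<omega> \<in> space M. \<theta> t \<omega>}"
      by auto
    then have "expectation (indicator {\<omega> \<in> space M. \<theta> t \<omega>}) = p"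
      using p by simp
    finally show ?thesis .
  qed
  have [simp]: "expectation (\<lambda>\<omega>. of_bool (\<not> \<theta> t \<omega>)) = 1 - p"
  proof -
    have "expectation (\<lambda>\<omega>. of_bool (\<not> \<theta> t \<omega>)) = expectation (\<lambda>\<omega>. 1 - of_bool (\<theta> t \<omega>))"
      by (rule Bochner_Integration.integral_cong) auto
    also have "\<dots> = 1 - p"
      using int[of "\<lambda>a. of_bool (a t)"] by (subst Bochner_Integration.integral_diff) (auto simp: prob_space)
    finally show ?thesis .
  qed
  have int2: "integrable M (\<lambda>\<omega>. G c (\<lambda>i. \<theta> i \<omega>) * g (\<theta> t \<omega>))" for c and g :: "bool \<Rightarrow> real"
  proof (rule int[of "\<lambda>a. G c a * g (a t)"])
    fix a b :: "nat \<Rightarrow> bool"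
    assume "\<And>i. i < Suc t \<Longrightarrow> a i = b i"
    then show "G c a * g (a t) = G c b * g (b t)"
      using G[of a b c] by simp
  qed
  have "expectation (\<lambda>\<omega>. G (\<theta> t \<omega>) (\<lambda>i. \<theta> i \<omega>))
    = expectation (\<lambda>\<omega>. G True (\<lambda>i. \<theta> i \<omega>) * of_bool (\<theta> t \<omega>)
        + G False (\<lambda>i. \<theta> i \<omega>) * of_bool (\<not> \<theta> t \<omega>))"
    by (rule Bochner_Integration.integral_cong) (auto simp: of_bool_def)
  also have "\<dots> = expectation (\<lambda>\<omega>. G True (\<lambda>i. \<theta> i \<omega>) * of_bool (\<theta> t \<omega>))
      + expectation (\<lambda>\<omega>. G False (\<lambda>i. \<theta> i \<omega>) * of_bool (\<not> \<theta> t \<omega>))"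
    by (intro Bochner_Integration.integral_add int2 int2[of _ "\<lambda>b. of_bool (\<not> b)"])
  also have "\<dots> = expectation (\<lambda>\<omega>. G True (\<lambda>i. \<theta> i \<omega>)) * p
      + expectation (\<lambda>\<omega>. G False (\<lambda>i. \<theta> i \<omega>)) * (1 - p)"
    using expectation_next_coin_mult[OF ind, of t "G True" of_bool, OF G]
      expectation_next_coin_mult[OF ind, of t "G False" "\<lambda>b. of_bool (\<not> b)", OF G] by simp
  also have "\<dots> = expectation (\<lambda>\<omega>. p * G True (\<lambda>i. \<theta> i \<omega>) + (1 - p) * G False (\<lambda>i. \<theta> i \<omega>))"
    by (simp add: intG mult.commute)
  finally show ?thesis .
qed

text \<open>The state at time \<open>t\<close> is a function of the coins before \<open>t\<close>,
  so \<open>F\<close> can be arbitrary in the first claim. The second averages over the next coin,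
  applies the statewise contraction and iterates.\<close>

lemma expectation_coin_driven_contraction:
  fixes s :: "(nat \<Rightarrow> bool) \<Rightarrow> nat \<Rightarrow> 's" and V :: "'s \<Rightarrow> real"
  assumes ind: "indep_vars (\<lambda>_. count_space UNIV) \<theta> UNIV"
    and p: "\<And>t. prob {\<omega> \<in> space M. \<theta> t \<omega>} = p"
    and s0: "\<And>a. s a 0 = s0" and s_Suc: "\<And>a t. s a (Suc t) = step (a t) (s a t)"
    and "\<rho> \<ge> 0"
    and contr: "\<And>x. p * V (step True x) + (1 - p) * V (step False x) \<le> \<rho> * V x"
  shows "integrable M (\<lambda>\<omega>. F (s (\<lambda>i. \<theta> i \<omega>) t) :: real)"
    and "expectation (\<lambda>\<omega>. V (s (\<lambda>i. \<theta> i \<omega>) t)) \<le> \<rho> ^ t * V s0"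
proof -
  have meas: "\<And>i. random_variable (count_space UNIV) (\<theta> i)"
    using ind by (simp add: indep_vars_def)
  have hist: "(\<And>i. i < t \<Longrightarrow> a i = b i) \<Longrightarrow> s a t = s b t" for t a b
  proof (induction t)
    case (Suc t)
    then have "s a t = s b t" "a t = b t"
      by (blast intro: less_SucI)+
    then show ?case
      by (simp only: s_Suc)
  qed (simp add: s0)
  have int: "integrable M (\<lambda>\<omega>. F (s (\<lambda>i. \<theta> i \<omega>) t) :: real)" for F t
    by (rule integrable_finite_history[OF meas, where G = "\<lambda>a. F (s a t)"]) (rule arg_cong[OF hist])
  then show "integrable M (\<lambda>\<omega>. F (s (\<lambda>i. \<theta> i \<omega>) t) :: real)" .
  show "expectation (\<lambda>\<omega>. V (s (\<lambda>i. \<theta> i \<omega>) t)) \<le> \<rho> ^ t * V s0"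
  proof (induction t)
    case 0
    then show ?case
      by (simp add: s0 prob_space)
  next
    case (Suc t)
    have "expectation (\<lambda>\<omega>. V (s (\<lambda>i. \<theta> i \<omega>) (Suc t)))
        = expectation (\<lambda>\<omega>. p * V (step True (s (\<lambda>i. \<theta> i \<omega>) t))
            + (1 - p) * V (step False (s (\<lambda>i. \<theta> i \<omega>) t)))"
      unfolding s_Suc
      by (rule expectation_next_coin[OF ind p, where G = "\<lambda>c a. V (step c (s a t))"])
        (rule arg_cong[OF hist])
    also have "\<dots> \<le> expectation (\<lambda>\<omega>. \<rho> * V (s (\<lambda>i. \<theta> i \<omega>) t))"
      by (intro integral_mono contr int[of "\<lambda>x. p * V (step True x) + (1 - p) * V (step False x)"]
          int[of "\<lambda>x. \<rho> * V x"])
    also have "\<dots> \<le> \<rho> * (\<rho> ^ t * V s0)"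
      using Suc \<open>\<rho> \<ge> 0\<close> by (simp add: mult_left_mono)
    finally show ?case
      by simp
  qed
qed

end

subsection \<open>The mixing operator and the Lyapunov function\<close>

text \<open>The Kronecker product of \<open>W\<close> with the identity, acting on one block per
  node. Blocks are stacked in \<open>'a^'n\<close> so that the Euclidean inner product of the
  product space is available.\<close>

definition mix :: "real^'n^'n \<Rightarrow> 'a::euclidean_space^'n \<Rightarrow> 'a^'n" where
  "mix W x = (\<chi> i. \<Sum>j\<in>UNIV. W $ i $ j *\<^sub>R x $ j)"

definition lap :: "real^'n^'n \<Rightarrow> 'a::euclidean_space^'n \<Rightarrow> 'a^'n" where
  "lap W x = x - mix W x"

lemma linear_mix: "linear (mix W)"
  by (rule linearI)
    (simp_all add: mix_def vec_eq_iff scaleR_right_distrib sum.distrib scaleR_sum_right mult.commute)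

lemma linear_lap: "linear (lap W)"
  unfolding lap_def[abs_def] using linear_mix[of W] by (intro linear_compose_sub linear_ident)

text \<open>Collecting one coordinate across all nodes gives a real vector on which
  \<open>mix W\<close> acts as \<open>W\<close>; this reduces facts about blocks to facts about the
  matrix.\<close>

lemma inner_vec_components:
  "x \<bullet> y = (\<Sum>b\<in>Basis. (\<chi> i. x $ i \<bullet> b) \<bullet> (\<chi> i. y $ i \<bullet> b))" for x y :: "'a::euclidean_space^'n"
proof -
  have "x \<bullet> y = (\<Sum>i\<in>UNIV. \<Sum>b\<in>Basis. (x $ i \<bullet> b) * (y $ i \<bullet> b))"
    unfolding inner_vec_def by (intro sum.cong refl euclidean_inner)
  also have "\<dots> = (\<Sum>b\<in>Basis. \<Sum>i\<in>UNIV. (x $ i \<bullet> b) * (y $ i \<bullet> b))"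
    by (rule sum.swap)
  finally show ?thesis
    by (simp add: inner_vec_def)
qed

lemma mix_component: "(\<chi> i. mix W x $ i \<bullet> b) = W *v (\<chi> i. x $ i \<bullet> b)"
  by (simp add: vec_eq_iff mix_def matrix_vector_mult_def inner_sum_left)

lemma mix_selfadjoint:
  assumes "symmetric_matrix W"
  shows "mix W x \<bullet> y = x \<bullet> mix W y"
proof -
  have "(W *v a) \<bullet> b = a \<bullet> (W *v b)" for a b
    using assms by (metis symmetric_matrix_def dot_lmul_matrix vector_transpose_matrix)
  then show ?thesis
    by (simp add: inner_vec_components[of "mix W x"] inner_vec_components[of x] mix_component)
qed

lemma mix_nonneg:
  assumes "positive_semidefinite W"
  shows "0 \<le> x \<bullet> mix W x"
  using assms by (simp add: inner_vec_components[of x] mix_component positive_semidefinite_def sum_nonneg)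

lemma lap_const:
  assumes "doubly_stochastic W"
  shows "lap W (\<chi> i. c) = 0"
  using assms by (simp add: doubly_stochastic_def lap_def mix_def vec_eq_iff flip: scaleR_sum_left)

lemma sum_lap:
  assumes "doubly_stochastic W"
  shows "(\<Sum>i\<in>UNIV. lap W x $ i) = 0"
proof -
  have "(\<Sum>i\<in>UNIV. mix W x $ i) = (\<Sum>j\<in>UNIV. \<Sum>i\<in>UNIV. W $ i $ j *\<^sub>R x $ j)"
    unfolding mix_def by (subst sum.swap) simp
  also have "\<dots> = (\<Sum>j\<in>UNIV. x $ j)"
    using assms by (simp add: doubly_stochastic_def flip: scaleR_sum_left)
  finally show ?thesis
    by (simp add: lap_def sum_subtractf)
qed

lemma lap_selfadjoint:
  assumes "symmetric_matrix W"
  shows "lap W x \<bullet> y = x \<bullet> lap W y"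
  using mix_selfadjoint[OF assms] by (simp add: lap_def inner_diff_left inner_diff_right)

lemma lap_gap_mean_zero:
  fixes W :: "real^'n^'n" and x :: "'a::euclidean_space^'n"
  assumes "CARD('n) \<ge> 2" "symmetric_matrix W" "doubly_stochastic W" "positive_semidefinite W"
    and x: "(\<Sum>i\<in>UNIV. x $ i) = 0"
  shows "spectral_gap W * (x \<bullet> x) \<le> x \<bullet> lap W x"
proof -
  have "x \<bullet> mix W x \<le> second_eigenvalue W * (x \<bullet> x)"
    unfolding inner_vec_components[of x] mix_component sum_distrib_left
  proof (rule sum_mono)
    fix b :: 'a
    have "(\<Sum>i\<in>UNIV. (\<chi> i. x $ i \<bullet> b) $ i) = 0"
      using x by (simp flip: inner_sum_left)
    from rayleigh_le_second_eigenvalue[OF assms(1-4) this]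
    show "(\<chi> i. x $ i \<bullet> b) \<bullet> (W *v (\<chi> i. x $ i \<bullet> b))
      \<le> second_eigenvalue W * ((\<chi> i. x $ i \<bullet> b) \<bullet> (\<chi> i. x $ i \<bullet> b))"
      by (simp add: power2_norm_eq_inner)
  qed
  then show ?thesis
    by (simp add: spectral_gap_def lap_def inner_diff_right left_diff_distrib)
qed

context
  fixes W :: "real^'n^'n"
  assumes W: "CARD('n) \<ge> 2" "symmetric_matrix W" "doubly_stochastic W" "positive_semidefinite W"
    and gap_pos: "spectral_gap W > 0"
begin

text \<open>Removing the mean does not change either side. For mean-zero \<open>y\<close>,
  Cauchy-Schwarz bounds the square of \<open>y \<bullet> lap W y\<close>, the gap bounds
  \<open>y \<bullet> y\<close>, and dividing by \<open>y \<bullet> lap W y\<close> gives the claim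
  without diagonalization.\<close>

lemma lap_gap:
  fixes x :: "'a::euclidean_space^'n"
  shows "spectral_gap W * (x \<bullet> lap W x) \<le> lap W x \<bullet> lap W x"
    and lap_nonneg: "0 \<le> x \<bullet> lap W x"
proof -
  define m :: "'a^'n" where "m = (\<chi> i. (1 / CARD('n)) *\<^sub>R (\<Sum>j\<in>UNIV. x $ j))"
  define y where "y = x - m"
  have lap_y: "lap W x = lap W y"
    by (simp add: y_def linear_diff[OF linear_lap] m_def lap_const[OF W(3)])
  have "(\<Sum>i\<in>UNIV. y $ i) = 0"
    by (simp add: y_def m_def sum_subtractf sum_constant_scaleR)
  from lap_gap_mean_zero[OF W this] have y: "spectral_gap W * (y \<bullet> y) \<le> y \<bullet> lap W y" .
  have "x \<bullet> lap W x = lap W x \<bullet> x"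
    by (rule inner_commute)
  also have "\<dots> = lap W x \<bullet> y"
    by (simp add: y_def inner_diff_right lap_selfadjoint[OF W(2)] m_def lap_const[OF W(3)])
  finally have eq: "x \<bullet> lap W x = y \<bullet> lap W y"
    by (simp add: lap_y inner_commute)
  show nonneg: "0 \<le> x \<bullet> lap W x"
    using y gap_pos unfolding eq by (smt (verit) inner_ge_zero mult_nonneg_nonneg)
  define s where "s = y \<bullet> lap W y"
  show "spectral_gap W * (x \<bullet> lap W x) \<le> lap W x \<bullet> lap W x"
  proof (cases "s = 0")
    case False
    then have "s > 0"
      using nonneg eq by (simp add: s_def)
    have "s * (spectral_gap W * s) = spectral_gap W * s\<^sup>2"
      by (simp add: power2_eq_square)
    also have "\<dots> \<le> spectral_gap W * ((y \<bullet> y) * (lap W y \<bullet> lap W y))"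
      using gap_pos unfolding s_def by (intro mult_left_mono Cauchy_Schwarz_ineq) simp
    also have "\<dots> \<le> s * (lap W y \<bullet> lap W y)"
      using mult_right_mono[OF y, of "lap W y \<bullet> lap W y"] by (simp add: s_def mult.assoc)
    finally show ?thesis
      using \<open>s > 0\<close> unfolding eq by (simp add: s_def[symmetric] lap_y)
  qed (simp add: eq s_def)
qed

text \<open>With \<open>A = I - W\<close>, the identity \<open>A - A A = A W A + W A W\<close> holds
  because \<open>A\<close> and \<open>W\<close> commute and sum to \<open>I\<close>; both terms on
  the right are positive semi-definite.\<close>

lemma lap_firmly_nonexpansive:
  fixes x :: "'a::euclidean_space^'n"
  shows "lap W x \<bullet> lap W x \<le> x \<bullet> lap W x"
proof -
  have split: "x = lap W x + mix W x"
    by (simp add: lap_def)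
  have comm: "mix W (lap W x) = lap W (mix W x)"
    by (simp add: lap_def linear_diff[OF linear_mix])
  have "x \<bullet> lap W x - lap W x \<bullet> lap W x = mix W x \<bullet> lap W x"
    by (simp add: lap_def inner_diff_left)
  also have "\<dots> = mix W x \<bullet> lap W (lap W x + mix W x)"
    using split by metis
  also have "\<dots> = lap W x \<bullet> mix W (lap W x) + mix W x \<bullet> lap W (mix W x)"
  proof -
    have "mix W x \<bullet> lap W (lap W x) = lap W x \<bullet> mix W (lap W x)"
      unfolding lap_selfadjoint[OF W(2), of "mix W x", symmetric] comm by (rule inner_commute)
    then show ?thesis
      by (simp add: linear_add[OF linear_lap] inner_add_right)
  qed
  also have "\<dots> \<ge> 0"
    by (intro add_nonneg_nonneg mix_nonneg[OF W(4)] lap_nonneg)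
  finally show ?thesis
    by simp
qed

text \<open>Adding the rank-one averaging operator makes \<open>lap W\<close> injective, hence surjective.\<close>

lemma lap_range:
  fixes h :: "'a::euclidean_space^'n"
  assumes h: "(\<Sum>i\<in>UNIV. h $ i) = 0"
  obtains z where "lap W z = h"
proof -
  define B where "B = (\<lambda>z :: 'a^'n. lap W z + (\<chi> i. \<Sum>j\<in>UNIV. z $ j))"
  \<comment> \<open>Summing over nodes kills the \<open>lap W\<close> part, so a zero sum of
    \<open>B z\<close> forces a zero sum of \<open>z\<close>, and then
    \<open>B z = lap W z\<close>.\<close>
  have sum_B: "(\<Sum>i\<in>UNIV. B z $ i) = CARD('n) *\<^sub>R (\<Sum>j\<in>UNIV. z $ j)" for z
    using sum_lap[OF W(3), of z] by (simp add: B_def sum.distrib sum_constant_scaleR)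
  have "linear (\<lambda>z :: 'a^'n. (\<chi> i::'n. \<Sum>j\<in>UNIV. z $ j))"
    by (rule linearI) (simp_all add: vec_eq_iff sum.distrib scaleR_sum_right)
  then have lin: "linear B"
    unfolding B_def by (intro linear_compose_add linear_lap)
  have "z = 0" if "B z = 0" for z
  proof -
    have mean: "(\<Sum>j\<in>UNIV. z $ j) = 0"
      using sum_B[of z] that by simp
    then have "lap W z = 0"
      using that by (simp add: B_def vec_eq_iff)
    with lap_gap_mean_zero[OF W mean] gap_pos show ?thesis
      by (metis inner_zero_right inner_eq_zero_iff inner_gt_zero_iff mult_pos_pos not_le)
  qed
  then have "inj B"
    using lin by (simp add: linear_injective_0)
  then have "surj B"
    using lin linear_injective_imp_surjective by blast
  then obtain z where z: "B z = h"
    by (metis surjD)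
  then have "(\<Sum>j\<in>UNIV. z $ j) = 0"
    using sum_B[of z] h by simp
  with z have "lap W z = h"
    by (simp add: B_def vec_eq_iff)
  then show ?thesis
    by (rule that)
qed

end

text \<open>Here \<open>u\<close> is the error after a gradient step with the optimal control
  variates, \<open>e\<close> the error with the current ones. Completing the square in
  \<open>u\<close> consumes the cross term between \<open>e\<close> and \<open>A z\<close> and
  leaves a negative multiple of \<open>A z \<bullet> A z\<close>.\<close>

lemma lyapunov_one_step:
  fixes A :: "'v::real_inner \<Rightarrow> 'v"
  assumes lin: "linear A" and selfadj: "\<And>x y. A x \<bullet> y = x \<bullet> A y"
    and fne: "\<And>x. A x \<bullet> A x \<le> x \<bullet> A x" and gap: "\<delta> * (z \<bullet> A z) \<le> A z \<bullet> A z"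
    and pos: "0 < p" "0 < \<gamma>" "0 < \<tau>" and "\<tau> \<le> p / \<gamma>"
    and e: "e = u + \<gamma> *\<^sub>R A z"
  shows "p * ((norm (e - (\<gamma> * \<tau> / p) *\<^sub>R A e))\<^sup>2
        + \<gamma> / (p * \<tau>) * ((z - \<tau> *\<^sub>R e) \<bullet> A (z - \<tau> *\<^sub>R e)))
      + (1 - p) * ((norm e)\<^sup>2 + \<gamma> / (p * \<tau>) * (z \<bullet> A z))
    \<le> (norm u)\<^sup>2 + (1 - p * \<gamma> * \<tau> * \<delta>) * (\<gamma> / (p * \<tau>) * (z \<bullet> A z))"
proof -
  define \<alpha> c where "\<alpha> = \<gamma> * \<tau> / p" and "c = \<gamma> / (p * \<tau>)"
  \<comment> \<open>The weight \<open>c\<close> is chosen for the second identity: it matches the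
    dual cross term with the one in the square of \<open>norm u\<close>.\<close>
  have coeffs: "p * \<alpha> = \<gamma> * \<tau>" "p * (c * \<tau>) = \<gamma>"
    using pos by (simp_all add: \<alpha>_def c_def)
  have "\<alpha> \<le> 1"
    using \<open>\<tau> \<le> p / \<gamma>\<close> pos by (simp add: \<alpha>_def field_simps)
  have sq: "(norm (e - \<alpha> *\<^sub>R A e))\<^sup>2 = e \<bullet> e - 2 * \<alpha> * (e \<bullet> A e) + \<alpha> * \<alpha> * (A e \<bullet> A e)"
    by (simp add: power2_norm_eq_inner inner_diff_left inner_diff_right inner_commute algebra_simps)
  have "z \<bullet> A e = e \<bullet> A z"
    by (metis selfadj inner_commute)
  then have quad: "(z - \<tau> *\<^sub>R e) \<bullet> A (z - \<tau> *\<^sub>R e)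
      = z \<bullet> A z - 2 * \<tau> * (e \<bullet> A z) + \<tau> * \<tau> * (e \<bullet> A e)"
    by (simp add: linear_diff[OF lin] linear_scale[OF lin] inner_diff_left inner_diff_right algebra_simps)
  have u: "u = e - \<gamma> *\<^sub>R A z"
    by (simp add: e)
  have uu: "(norm u)\<^sup>2 = e \<bullet> e - 2 * \<gamma> * (e \<bullet> A z) + \<gamma> * \<gamma> * (A z \<bullet> A z)"
    unfolding u by (simp add: power2_norm_eq_inner inner_diff_left inner_diff_right inner_commute algebra_simps)
  have "p * ((norm (e - \<alpha> *\<^sub>R A e))\<^sup>2 + c * ((z - \<tau> *\<^sub>R e) \<bullet> A (z - \<tau> *\<^sub>R e)))
      + (1 - p) * ((norm e)\<^sup>2 + c * (z \<bullet> A z))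
    = e \<bullet> e + c * (z \<bullet> A z) - 2 * (p * \<alpha>) * (e \<bullet> A e) + (p * \<alpha>) * \<alpha> * (A e \<bullet> A e)
      - 2 * (p * (c * \<tau>)) * (e \<bullet> A z) + (p * (c * \<tau>)) * \<tau> * (e \<bullet> A e)"
    unfolding sq quad power2_norm_eq_inner[of e] by (simp add: algebra_simps)
  also have "\<dots> = (norm u)\<^sup>2 - \<gamma> * \<gamma> * (A z \<bullet> A z) + c * (z \<bullet> A z)
      - \<gamma> * \<tau> * (e \<bullet> A e - \<alpha> * (A e \<bullet> A e))"
    unfolding coeffs uu by (simp add: algebra_simps)
  also have "\<dots> \<le> (norm u)\<^sup>2 - \<gamma> * \<gamma> * (A z \<bullet> A z) + c * (z \<bullet> A z)"
  proof -
    have "\<alpha> * (A e \<bullet> A e) \<le> 1 * (A e \<bullet> A e)"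
      using \<open>\<alpha> \<le> 1\<close> by (intro mult_right_mono) auto
    then have "0 \<le> e \<bullet> A e - \<alpha> * (A e \<bullet> A e)"
      using fne[of e] by simp
    then show ?thesis
      using pos by simp
  qed
  also have "\<dots> \<le> (norm u)\<^sup>2 - \<gamma> * \<gamma> * (\<delta> * (z \<bullet> A z)) + c * (z \<bullet> A z)"
    using mult_left_mono[OF gap, of "\<gamma> * \<gamma>"] pos by simp
  \<comment> \<open>One \<open>\<gamma>\<close> is written back in terms of \<open>c\<close>, so the
    decrease becomes a fraction of the dual term.\<close>
  also have "\<dots> = (norm u)\<^sup>2 - (p * (c * \<tau>)) * \<gamma> * (\<delta> * (z \<bullet> A z)) + c * (z \<bullet> A z)"
    unfolding coeffs ..
  also have "\<dots> = (norm u)\<^sup>2 + (1 - p * \<gamma> * \<tau> * \<delta>) * (c * (z \<bullet> A z))"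
    by (simp add: algebra_simps)
  finally show ?thesis
    unfolding \<alpha>_def c_def .
qed

text \<open>Convexity of the squared norm, in the form of Cauchy-Schwarz for sums.\<close>

lemma norm_mean_diff_le:
  fixes x :: "'a::euclidean_space^'n"
  shows "(norm ((1 / real CARD('n)) *\<^sub>R (\<Sum>i\<in>UNIV. x $ i) - c))\<^sup>2
    \<le> (norm (x - (\<chi> i. c)))\<^sup>2 / real CARD('n)"
proof -
  let ?n = "real CARD('n)"
  have "(1 / ?n) *\<^sub>R (\<Sum>i\<in>UNIV. x $ i) - c = (1 / ?n) *\<^sub>R (\<Sum>i\<in>UNIV. x $ i - c)"
    by (simp add: sum_subtractf sum_constant_scaleR scaleR_diff_right)
  then have "(norm ((1 / ?n) *\<^sub>R (\<Sum>i\<in>UNIV. x $ i) - c))\<^sup>2 = (norm (\<Sum>i\<in>UNIV. x $ i - c))\<^sup>2 / ?n\<^sup>2"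
    by (simp add: power_divide)
  also have "\<dots> \<le> (\<Sum>i\<in>UNIV. norm (x $ i - c))\<^sup>2 / ?n\<^sup>2"
    by (intro divide_right_mono power_mono norm_sum) auto
  also have "\<dots> \<le> (\<Sum>i\<in>UNIV. (norm (x $ i - c))\<^sup>2) * ?n / ?n\<^sup>2"
    by (intro divide_right_mono sum_squared_le_sum_of_squares) auto
  also have "\<dots> = (norm (x - (\<chi> i. c)))\<^sup>2 / ?n"
    by (simp add: power2_norm_eq_inner inner_vec_def) (simp add: power2_eq_square)
  finally show ?thesis .
qed

text \<open>The algorithm in the coordinates \<open>(x, z)\<close>, where \<open>z\<close> encodes the control variates \<open>hs + A z\<close>.\<close>

definition lifted_step ::
  "('v::real_inner \<Rightarrow> 'v) \<Rightarrow> ('v \<Rightarrow> 'v) \<Rightarrow> 'v \<Rightarrow> 'v \<Rightarrow> real \<Rightarrow> real \<Rightarrow> real \<Rightarrow> bool \<Rightarrow> 'v \<times> 'v \<Rightarrow> 'v \<times> 'v" where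
  "lifted_step G A xs hs \<gamma> \<tau> p b = (\<lambda>(x, z).
     let e = x - \<gamma> *\<^sub>R (G x - (hs + A z)) - xs
     in if b then (xs + e - (\<gamma> * \<tau> / p) *\<^sub>R A e, z - \<tau> *\<^sub>R e) else (xs + e, z))"

text \<open>For self-adjoint \<open>A\<close>, the form \<open>z \<bullet> A z\<close> is the
  squared dual error \<open>A z\<close> measured by the pseudo-inverse of \<open>A\<close>; it
  depends on \<open>z\<close> only through \<open>A z\<close>.\<close>

definition lyapunov :: "('v::real_inner \<Rightarrow> 'v) \<Rightarrow> 'v \<Rightarrow> real \<Rightarrow> 'v \<times> 'v \<Rightarrow> real" where
  "lyapunov A xs c = (\<lambda>(x, z). (norm (x - xs))\<^sup>2 + c * (z \<bullet> A z))"

text \<open>The primal rate comes from the assumption on \<open>G\<close>, the dual rate from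
  \<open>lyapunov_one_step\<close>; nonnegativity of both terms lets the slower rate serve for their
  sum.\<close>

lemma lifted_step_contraction:
  fixes A :: "'v::real_inner \<Rightarrow> 'v"
  assumes lin: "linear A" and selfadj: "\<And>x y. A x \<bullet> y = x \<bullet> A y"
    and fne: "\<And>x. A x \<bullet> A x \<le> x \<bullet> A x" and gap: "\<And>z. \<delta> * (z \<bullet> A z) \<le> A z \<bullet> A z"
    and pos: "0 < p" "0 < \<gamma>" "0 < \<tau>" and "\<tau> \<le> p / \<gamma>"
    and G: "\<And>x. (norm (x - xs - \<gamma> *\<^sub>R (G x - hs)))\<^sup>2 \<le> (1 - \<gamma> * \<mu>) * (norm (x - xs))\<^sup>2"
  defines "V \<equiv> lyapunov A xs (\<gamma> / (p * \<tau>))"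
  shows "p * V (lifted_step G A xs hs \<gamma> \<tau> p True s) + (1 - p) * V (lifted_step G A xs hs \<gamma> \<tau> p False s)
    \<le> (1 - min (\<gamma> * \<mu>) (p * \<gamma> * \<tau> * \<delta>)) * V s"
proof (cases s)
  case (Pair x z)
  define u where "u = x - xs - \<gamma> *\<^sub>R (G x - hs)"
  define e where "e = x - \<gamma> *\<^sub>R (G x - (hs + A z)) - xs"
  define q where "q = \<gamma> / (p * \<tau>) * (z \<bullet> A z)"
  have eu: "e = u + \<gamma> *\<^sub>R A z"
    by (simp add: e_def u_def algebra_simps)
  have "0 \<le> z \<bullet> A z"
    using fne[of z] by (meson inner_ge_zero order_trans)
  then have "q \<ge> 0"
    using pos by (simp add: q_def)
  let ?m = "min (\<gamma> * \<mu>) (p * \<gamma> * \<tau> * \<delta>)"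
  have "p * V (lifted_step G A xs hs \<gamma> \<tau> p True s) + (1 - p) * V (lifted_step G A xs hs \<gamma> \<tau> p False s)
    = p * ((norm (e - (\<gamma> * \<tau> / p) *\<^sub>R A e))\<^sup>2
        + \<gamma> / (p * \<tau>) * ((z - \<tau> *\<^sub>R e) \<bullet> A (z - \<tau> *\<^sub>R e)))
      + (1 - p) * ((norm e)\<^sup>2 + \<gamma> / (p * \<tau>) * (z \<bullet> A z))"
  proof -
    have "xs + e - y - xs = e - y" for y
      by simp
    then show ?thesis
      unfolding Pair V_def lyapunov_def lifted_step_def prod.case Let_def e_def[symmetric] by simp
  qed
  also have "\<dots> \<le> (norm u)\<^sup>2 + (1 - p * \<gamma> * \<tau> * \<delta>) * q"
    unfolding q_def by (rule lyapunov_one_step[OF lin selfadj fne gap pos \<open>\<tau> \<le> p / \<gamma>\<close> eu])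
  also have "\<dots> \<le> (1 - ?m) * (norm (x - xs))\<^sup>2 + (1 - ?m) * q"
  proof (rule add_mono)
    have "(norm u)\<^sup>2 \<le> (1 - \<gamma> * \<mu>) * (norm (x - xs))\<^sup>2"
      unfolding u_def by (rule G)
    also have "\<dots> \<le> (1 - ?m) * (norm (x - xs))\<^sup>2"
      by (rule mult_right_mono) auto
    finally show "(norm u)\<^sup>2 \<le> (1 - ?m) * (norm (x - xs))\<^sup>2" .
    show "(1 - p * \<gamma> * \<tau> * \<delta>) * q \<le> (1 - ?m) * q"
      using \<open>q \<ge> 0\<close> by (intro mult_right_mono) auto
  qed
  finally show ?thesis
    by (simp add: Pair V_def lyapunov_def q_def distrib_left)
qed

text \<open>The map \<open>r\<close> intertwines the two recursions: consensus vectors lie in the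
  kernel of \<open>lap W\<close>, so mixing sees only \<open>e\<close>, and the factors
  \<open>p / \<gamma>\<close> and \<open>\<gamma> * \<tau> / p\<close> multiply to
  \<open>\<tau>\<close>, the step taken by \<open>z\<close>.\<close>

lemma scaffnew_step_lifted_step:
  fixes f :: "'n::finite \<Rightarrow> 'a::euclidean_space \<Rightarrow> real" and W :: "real^'n^'n"
    and hs :: "'a^'n"
  assumes "doubly_stochastic W" "0 < \<gamma>" "0 < p"
  defines "G \<equiv> \<lambda>x. \<chi> i. gradient (f i) (x $ i)"
    and "r \<equiv> \<lambda>(x, z). (($) x, ($) (hs + lap W z))"
  shows "scaffnew_step f W \<gamma> \<tau> p b (r s)
    = r (lifted_step G (lap W) (\<chi> i. xstar) hs \<gamma> \<tau> p b s)"
proof (cases s)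
  case (Pair x z)
  define xs :: "'a^'n" where "xs = (\<chi> i. xstar)"
  define e where "e = x - \<gamma> *\<^sub>R (G x - (hs + lap W z)) - xs"
  define xh where "xh = xs + e"
  have xh: "x $ i - \<gamma> *\<^sub>R (gradient (f i) (x $ i) - (hs + lap W z) $ i) = xh $ i" for i
    by (simp add: xh_def e_def G_def)
  have lap_xh: "lap W xh = lap W e"
    using lap_const[OF assms(1)] by (simp add: xh_def xs_def linear_add[OF linear_lap])
  have xn: "(1 - \<gamma> * \<tau> / p) *\<^sub>R xh $ i + (\<gamma> * \<tau> / p) *\<^sub>R (\<Sum>j\<in>UNIV. W $ i $ j *\<^sub>R xh $ j)
      = (xs + e - (\<gamma> * \<tau> / p) *\<^sub>R lap W e) $ i" for i
    unfolding lap_xh[symmetric] xh_def[symmetric]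
    by (simp add: lap_def mix_def algebra_simps)
  have h: "(hs + lap W z) $ i + (p / \<gamma>) *\<^sub>R ((xs + e - (\<gamma> * \<tau> / p) *\<^sub>R lap W e) $ i - xh $ i)
      = (hs + lap W (z - \<tau> *\<^sub>R e)) $ i" for i
    using assms(2,3)
    by (simp add: xh_def linear_diff[OF linear_lap] linear_scale[OF linear_lap])
  have "scaffnew_step f W \<gamma> \<tau> p b (($) x, ($) (hs + lap W z))
    = (if b then (($) (xs + e - (\<gamma> * \<tau> / p) *\<^sub>R lap W e), ($) (hs + lap W (z - \<tau> *\<^sub>R e)))
       else (($) xh, ($) (hs + lap W z)))"
    unfolding scaffnew_step_def prod.case Let_def xh xn h ..
  also have "\<dots> = r (lifted_step G (lap W) xs hs \<gamma> \<tau> p b (x, z))"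
    unfolding r_def lifted_step_def prod.case Let_def e_def[symmetric] xh_def by simp
  finally show ?thesis
    by (simp add: Pair r_def xs_def)
qed

theorem theorem5p7:
  fixes f :: "'n::finite \<Rightarrow> real^'d \<Rightarrow> real"
    and W :: "real^'n^'n"
    and L \<mu> \<gamma> \<tau> p \<delta> :: real
    and x0 xstar :: "real^'d"
    and M :: "'w measure"
    and \<theta> :: "nat \<Rightarrow> 'w \<Rightarrow> bool"
  assumes "CARD('n) \<ge> 2"
    and "\<And>i. smooth_fun L (f i)"
    and "\<mu> > 0"
    and "\<And>i. strongly_convex \<mu> (f i)"
    and "is_arg_min (\<lambda>x. (1 / real CARD('n)) * (\<Sum>i\<in>UNIV. f i x)) (\<lambda>_. True) xstar"
    and "symmetric_matrix W"
    and "doubly_stochastic W"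
    and "positive_semidefinite W"
    and "\<And>i j. W $ i $ j \<in> {0..1}"
    and "\<delta> = spectral_gap W"
    and "\<delta> \<in> {0<..<1}"
    and "0 < p" "p \<le> 1"
    and "0 < \<gamma>" "\<gamma> \<le> 1 / L"
    and "0 < \<tau>" "\<tau> \<le> p / \<gamma>"
    and "prob_space M"
    and "prob_space.indep_vars M (\<lambda>_. count_space UNIV) \<theta> UNIV"
    and "\<And>t. measure M {\<omega> \<in> space M. \<theta> t \<omega>} = p"
  shows "\<exists>\<Phi>0. \<Phi>0 \<le> (norm (x0 - xstar))\<^sup>2
               + \<gamma> / (p * \<tau> * \<delta> * real CARD('n))
                 * (\<Sum>i\<in>UNIV. (norm (gradient (f i) xstar))\<^sup>2)
           \<and> (\<forall>T\<ge>1. prob_space.expectation M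
                 (\<lambda>\<omega>. (norm (scaffnew_mean f W \<gamma> \<tau> p x0 (\<lambda>t. \<theta> t \<omega>) T - xstar))\<^sup>2)
               \<le> (1 - min (\<gamma> * \<mu>) (p * \<gamma> * \<tau> * \<delta>)) ^ T * \<Phi>0)"
proof -
  interpret prob_space M
    by fact
  note W = assms(1,6,7,8)
  have \<delta>: "0 < \<delta>" "\<delta> < 1" "\<delta> = spectral_gap W" "0 < spectral_gap W"
    using assms(10,11) by auto
  let ?n = "real CARD('n)"
  define G where "G = (\<lambda>x :: (real^'d)^'n. \<chi> i. gradient (f i) (x $ i))"
  define xs :: "(real^'d)^'n" where "xs = (\<chi> i. xstar)"
  define hs where "hs = G xs"
  define c where "c = \<gamma> / (p * \<tau>)"
  define V where "V = lyapunov (lap W) xs c"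
  define \<rho> where "\<rho> = 1 - min (\<gamma> * \<mu>) (p * \<gamma> * \<tau> * \<delta>)"
  have "(\<Sum>i\<in>UNIV. gradient (f i) xstar) = 0"
    using assms(2,5) by (intro minimizer_sum_gradient[of f "1 / ?n"]) (auto simp: smooth_fun_def)
  then have "(\<Sum>i\<in>UNIV. (- hs) $ i) = 0"
    by (simp add: hs_def G_def xs_def sum_negf)
  \<comment> \<open>The control variates start at zero, so the initial \<open>z0\<close> must
    satisfy \<open>hs + lap W z0 = 0\<close>.\<close>
  then obtain z0 where z0: "lap W z0 = - hs"
    using lap_range[OF W \<delta>(4)] by blast
  define s where "s = (\<lambda>a. rec_nat (\<chi> i. x0, z0) (\<lambda>t. lifted_step G (lap W) xs hs \<gamma> \<tau> p (a t)))"
  have s_0: "s a 0 = (\<chi> i. x0, z0)" and s_Suc: "s a (Suc t) = lifted_step G (lap W) xs hs \<gamma> \<tau> p (a t) (s a t)" for a t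
    by (simp_all add: s_def)
  have state: "scaffnew_state f W \<gamma> \<tau> p x0 a t = (($) (fst (s a t)), ($) (hs + lap W (snd (s a t))))" for a t
  proof (induction t)
    case 0
    show ?case
      by (simp add: s_0 z0 fun_eq_iff)
  next
    case (Suc t)
    show ?case
      unfolding scaffnew_state.simps(2) Suc s_Suc
      using scaffnew_step_lifted_step[OF assms(7,14,12), of f \<tau> "a t" hs "s a t" xstar,
          folded G_def xs_def]
      by (simp only: case_prod_beta)
  qed
  have contr: "p * V (lifted_step G (lap W) xs hs \<gamma> \<tau> p True x)
      + (1 - p) * V (lifted_step G (lap W) xs hs \<gamma> \<tau> p False x) \<le> \<rho> * V x" for x
    unfolding V_def c_def \<rho>_def
  proof (rule lifted_step_contraction[OF linear_lap lap_selfadjoint[OF W(2)]])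
    fix x :: "(real^'d)^'n"
    have "(norm (x $ i - xstar - \<gamma> *\<^sub>R (gradient (f i) (x $ i) - gradient (f i) xstar)))\<^sup>2
        \<le> (1 - \<gamma> * \<mu>) * (norm (x $ i - xstar))\<^sup>2" for i
      using assms(2,3,4,14,15) by (intro gradient_step_contraction) auto
    then have "(\<Sum>i\<in>UNIV. (norm ((x - xs - \<gamma> *\<^sub>R (G x - hs)) $ i))\<^sup>2)
        \<le> (\<Sum>i\<in>UNIV. (1 - \<gamma> * \<mu>) * (norm ((x - xs) $ i))\<^sup>2)"
      by (intro sum_mono) (simp add: G_def hs_def xs_def)
    then show "(norm (x - xs - \<gamma> *\<^sub>R (G x - hs)))\<^sup>2 \<le> (1 - \<gamma> * \<mu>) * (norm (x - xs))\<^sup>2"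
      by (simp only: power2_norm_eq_inner inner_vec_def sum_distrib_left)
  qed (use assms lap_gap[OF W \<delta>(4)] lap_firmly_nonexpansive[OF W \<delta>(4)] \<delta> in auto)
  \<comment> \<open>It suffices that the second entry of the minimum is at most 1, which follows
    from \<open>\<gamma> * \<tau> \<le> p \<le> 1\<close> and \<open>\<delta> < 1\<close>.\<close>
  have "\<rho> \<ge> 0"
  proof -
    have "\<gamma> * \<tau> \<le> p"
      using assms(14,17) by (simp add: field_simps)
    then have "p * (\<gamma> * \<tau>) * \<delta> \<le> 1 * 1 * 1"
      using assms(12,13,14,16) \<delta> by (intro mult_mono) auto
    then show ?thesis
      by (simp add: \<rho>_def mult.assoc min_le_iff_disj)
  qed
  \<comment> \<open>The witness for \<open>\<Phi>0\<close> is the initial Lyapunov value divided by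
    the number of nodes, since the mean's squared error is at most that fraction of the stacked
    one.\<close>
  note coin = expectation_coin_driven_contraction[where s = s, OF assms(19,20) s_0 s_Suc \<open>\<rho> \<ge> 0\<close> contr]
  have mean_le: "expectation (\<lambda>\<omega>. (norm (scaffnew_mean f W \<gamma> \<tau> p x0 (\<lambda>t. \<theta> t \<omega>) T - xstar))\<^sup>2)
      \<le> \<rho> ^ T * (V (\<chi> i. x0, z0) / ?n)" for T
  proof -
    define F where "F = (\<lambda>y :: ((real^'d)^'n) \<times> ((real^'d)^'n). (norm ((1 / ?n) *\<^sub>R (\<Sum>i\<in>UNIV. fst y $ i) - xstar))\<^sup>2)"
    have "F y \<le> V y / ?n" for y
    proof -
      have "F y \<le> (norm (fst y - xs))\<^sup>2 / ?n"
        unfolding F_def xs_def by (rule norm_mean_diff_le)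
      also have "\<dots> \<le> V y / ?n"
        using lap_nonneg[OF W \<delta>(4), of "snd y"] assms(12,14,16)
        by (intro divide_right_mono) (auto simp: V_def lyapunov_def c_def case_prod_beta)
      finally show ?thesis .
    qed
    then have "expectation (\<lambda>\<omega>. F (s (\<lambda>t. \<theta> t \<omega>) T)) \<le> expectation (\<lambda>\<omega>. V (s (\<lambda>t. \<theta> t \<omega>) T) / ?n)"
      by (intro integral_mono coin(1)[of F] coin(1)[of "\<lambda>y. V y / ?n"])
    also have "\<dots> = expectation (\<lambda>\<omega>. V (s (\<lambda>t. \<theta> t \<omega>) T)) / ?n"
      by simp
    also have "\<dots> \<le> \<rho> ^ T * V (\<chi> i. x0, z0) / ?n"
      by (intro divide_right_mono coin(2)) auto
    finally show ?thesis
      by (simp add: F_def scaffnew_mean_def state)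
  qed
  have "V (\<chi> i. x0, z0) / ?n \<le> (norm (x0 - xstar))\<^sup>2
      + \<gamma> / (p * \<tau> * \<delta> * ?n) * (\<Sum>i\<in>UNIV. (norm (gradient (f i) xstar))\<^sup>2)"
  proof -
    \<comment> \<open>The gap inequality at \<open>z0\<close> trades the unknown \<open>z0\<close>
      for \<open>hs\<close>, because \<open>lap W z0 = - hs\<close>; this is the source of the
      factor \<open>1 / \<delta>\<close>.\<close>
    have "\<delta> * (z0 \<bullet> lap W z0) \<le> hs \<bullet> hs"
      using lap_gap[OF W \<delta>(4), of z0] by (simp add: z0 \<delta>(3))
    then have "z0 \<bullet> lap W z0 \<le> (hs \<bullet> hs) / \<delta>"
      using \<delta>(1) by (simp add: field_simps)
    then have "c * (z0 \<bullet> lap W z0) / ?n \<le> c * ((hs \<bullet> hs) / \<delta>) / ?n"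
      using assms(12,14,16) by (intro divide_right_mono mult_left_mono) (auto simp: c_def)
    also have "\<dots> = \<gamma> / (p * \<tau> * \<delta> * ?n) * (hs \<bullet> hs)"
      by (simp add: c_def)
    also have "hs \<bullet> hs = (\<Sum>i\<in>UNIV. (norm (gradient (f i) xstar))\<^sup>2)"
      by (simp add: hs_def G_def xs_def inner_vec_def power2_norm_eq_inner)
    finally have "c * (z0 \<bullet> lap W z0) / ?n
        \<le> \<gamma> / (p * \<tau> * \<delta> * ?n) * (\<Sum>i\<in>UNIV. (norm (gradient (f i) xstar))\<^sup>2)" .
    moreover have "(norm ((\<chi> i. x0) - xs))\<^sup>2 / ?n = (norm (x0 - xstar))\<^sup>2"
      by (simp add: power2_norm_eq_inner inner_vec_def xs_def)
    ultimately show ?thesis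
      by (simp add: V_def lyapunov_def add_divide_distrib)
  qed
  with mean_le show ?thesis
    unfolding \<rho>_def by blast
qed

end
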